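(* Let $D\geq 0$, let $r_0,r_1\in\mathbb{C}^\times$, let $\rho\in\{r_0,r_0^{-1}\}$, $\sigma\in\{r_1,r_1^{-1}\}$, and let $c=(c_0,\dots,c_{D-1})$, $s=(s_0,\dots,s_{D-1})$, $\lambda=(\lambda_0,\dots,\lambda_{D-1})$, $\mu=(\mu_0,\dots,\mu_{D-1})$ be tuples of nonzero complex scalars. Then the defining ordered basis $\mathfrak{B}_O=\{a_0,b_0,a_1,b_1,\dots,a_{D-1},b_{D-1},a_D\}$ (with $\mathfrak{B}_O=\{a_0\}$ if $D=0$) of the $\widetilde{\mathcal H}$-module $O_D=O_D(\rho,\sigma;c,s,\lambda,\mu)$ is an adapted block basis for $O_D$.
   Context: For nonzero $r_0,r_1\in\mathbb{C}$, $\widetilde{\mathcal H}=\widetilde{\mathcal H}(r_0,r_1)$ is the unital associative $\mathbb{C}$-algebra generated by $t_0,u_0,t_1,u_1$ subject to the relations (i) $(t_i-r_i)(t_i-r_i^{-1})=0$ for $i\in\{0,1\}$; (ii) $u_0^2=u_0$; (iii) $u_1^2=0$; (iv) $u_0t_0t_1u_1=0=t_1u_1u_0t_0$. Set $A=u_0t_0$ and $B=t_1u_1$. For a finite-dimensional module $V$ and $\alpha,\beta\in\mathbb{C}$ let $V_{\alpha,\beta}=\{v\in V: Av=\alpha v,\ Bv=\beta v\}$. For a $(2D+1)$-dimensional $\widetilde{\mathcal H}$-module $V$ with $D\ge1$, an (odd) adapted block basis is an ordered basis $a_0,b_0,a_1,b_1,\ldots,a_{D-1},b_{D-1},a_D$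 of $V$ for which there are nonzero scalars $\lambda_0,\dots,\lambda_D,\mu_0,\dots,\mu_{D-1}$ such that: $a_i\in V_{\lambda_i,0}$ for $0\le i\le D$; $b_i\in V_{0,\mu_i}$ for $0\le i\le D-1$; $t_0$ preserves $\mathbb{C}a_D$ and $t_1$ preserves $\mathbb{C}a_0$; $t_0$ preserves $\mathrm{span}\{a_i,b_i\}$ for $0\le i\le D-1$; $t_1$ preserves $\mathrm{span}\{b_i,a_{i+1}\}$ for $0\le i\le D-1$. If $\dim V=1$, a basis $\{a_0\}$ is an (odd) adapted block basis if $a_0\in V_{\lambda_0,0}$ for some $\lambda_0\in\mathbb{C}^\times$. Here "$t_i$ preserves $W$" means $t_iW\subseteq W$. For $c,r,s,\lambda,\mu\in\mathbb{C}^{\times}$ put $k(r)=r+r^{-1}$ and $$R(r,\lambda,c)=\begin{pmatrix}k(r)-\lambda^{-1}&-c\lambda^{-1}\\ c^{-1}(\lambda-k(r)+\lambda^{-1})&\lambda^{-1}\end{pmatrix},\quad P(c)=\begin{pmatrix}1&c\\0&0\end{pmatrix},$$ $$S(r,s)=\begin{pmatrix}k(r)&s\\-s^{-1}&0\end{pmatrix},\quad N(s,\mu)=\begin{pmatrix}0&0\\ s^{-1}\mu&0\end{pmatrix}.$$ Matrices act on coordinate column vectors. $O_D(\rho,\sigma;c,s,\lambda,\mu)$ is the $(2D+1)$-dimensional $\widetilde{\mathcal H}$-module with ordered basis $\mathfrak{B}_O$ on which $t_0,u_0,t_1,u_1$ are represented respectively by $\operatorname{blockdiag}(R_0,\dots,R_{D-1},[\rho])$,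 $\operatorname{blockdiag}(P_0,\dots,P_{D-1},[1])$, $\operatorname{blockdiag}([\sigma],S_0,\dots,S_{D-1})$, $\operatorname{blockdiag}([0],N_0,\dots,N_{D-1})$, where $R_i=R(r_0,\lambda_i,c_i)$, $P_i=P(c_i)$, $S_i=S(r_1,s_i)$, $N_i=N(s_i,\mu_i)$ for $0\le i\le D-1$. When $D=0$ all tuples are empty and the matrices are $[\rho],[1],[\sigma],[0]$. *)

theory Defs
  imports "Jordan_Normal_Form.VS_Connect" "HOL-Library.Poly_Mapping" "HOL-Algebra.QuotRing"
begin

section \<open>The algebra\<close>

datatype gen = T0 | U0 | T1 | U1

text \<open>Words form a separate type, so that they can carry the free monoid structure (written
  additively), which makes \<open>word \<Rightarrow>\<^sub>0 complex\<close> with its convolution product the free unital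
  associative algebra on \<^typ>\<open>gen\<close>.\<close>

datatype word = Word (letters: "gen list")

instantiation word :: monoid_add
begin
definition zero_word :: word where "zero_word = Word []"
definition plus_word :: "word \<Rightarrow> word \<Rightarrow> word" where "plus_word u v = Word (letters u @ letters v)"
instance by standard (simp_all add: zero_word_def plus_word_def)
end

type_synonym free_alg = "word \<Rightarrow>\<^sub>0 complex"

abbreviation free_ring :: "free_alg ring" where
  "free_ring \<equiv> class_ring"

definition free_gen :: "gen \<Rightarrow> free_alg" where
  "free_gen g = Poly_Mapping.single (Word [g]) 1"

definition free_scalar :: "complex \<Rightarrow> free_alg" where
  "free_scalar z = Poly_Mapping.single 0 z"

definition relators :: "complex \<Rightarrow> complex \<Rightarrow> free_alg set" where
  "relators r0 r1 =
    (let t0 = free_gen T0; u0 = free_gen U0; t1 = free_gen T1; u1 = free_gen U1 in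
     {(t0 - free_scalar r0) * (t0 - free_scalar (inverse r0)),
      (t1 - free_scalar r1) * (t1 - free_scalar (inverse r1)),
      u0 * u0 - u0,
      u1 * u1,
      u0 * t0 * t1 * u1,
      t1 * u1 * u0 * t0})"

definition rel_ideal :: "complex \<Rightarrow> complex \<Rightarrow> free_alg set" where
  "rel_ideal r0 r1 = Idl\<^bsub>free_ring\<^esub> (relators r0 r1)"

definition Htilde :: "complex \<Rightarrow> complex \<Rightarrow> free_alg set ring" where
  "Htilde r0 r1 = free_ring Quot (rel_ideal r0 r1)"

definition Hclass :: "complex \<Rightarrow> complex \<Rightarrow> free_alg \<Rightarrow> free_alg set" where
  "Hclass r0 r1 p = rel_ideal r0 r1 +>\<^bsub>free_ring\<^esub> p"

definition Hgen :: "complex \<Rightarrow> complex \<Rightarrow> gen \<Rightarrow> free_alg set" where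
  "Hgen r0 r1 g = Hclass r0 r1 (free_gen g)"

definition HA :: "complex \<Rightarrow> complex \<Rightarrow> free_alg set" where
  "HA r0 r1 = Hgen r0 r1 U0 \<otimes>\<^bsub>Htilde r0 r1\<^esub> Hgen r0 r1 T0"

definition HB :: "complex \<Rightarrow> complex \<Rightarrow> free_alg set" where
  "HB r0 r1 = Hgen r0 r1 T1 \<otimes>\<^bsub>Htilde r0 r1\<^esub> Hgen r0 r1 U1"


section \<open>Modules and adapted block bases\<close>

text \<open>Unital left modules; the library's \<^locale>\<open>module\<close> requires a commutative ring.\<close>

locale left_module = R?: ring R + M?: abelian_group M
    for R :: "('a, 'r) ring_scheme" (structure) and M :: "('a, 'v, 'm) module_scheme" (structure) +
  assumes smult_closed:
      "\<lbrakk>a \<in> carrier R; x \<in> carrier M\<rbrakk> \<Longrightarrow> a \<odot>\<^bsub>M\<^esub> x \<in> carrier M"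
    and smult_l_distr:
      "\<lbrakk>a \<in> carrier R; b \<in> carrier R; x \<in> carrier M\<rbrakk> \<Longrightarrow>
       (a \<oplus> b) \<odot>\<^bsub>M\<^esub> x = a \<odot>\<^bsub>M\<^esub> x \<oplus>\<^bsub>M\<^esub> b \<odot>\<^bsub>M\<^esub> x"
    and smult_r_distr:
      "\<lbrakk>a \<in> carrier R; x \<in> carrier M; y \<in> carrier M\<rbrakk> \<Longrightarrow>
       a \<odot>\<^bsub>M\<^esub> (x \<oplus>\<^bsub>M\<^esub> y) = a \<odot>\<^bsub>M\<^esub> x \<oplus>\<^bsub>M\<^esub> a \<odot>\<^bsub>M\<^esub> y"
    and smult_assoc1:
      "\<lbrakk>a \<in> carrier R; b \<in> carrier R; x \<in> carrier M\<rbrakk> \<Longrightarrow>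
       (a \<otimes> b) \<odot>\<^bsub>M\<^esub> x = a \<odot>\<^bsub>M\<^esub> (b \<odot>\<^bsub>M\<^esub> x)"
    and smult_one:
      "x \<in> carrier M \<Longrightarrow> \<one> \<odot>\<^bsub>M\<^esub> x = x"

text \<open>The complex vector space underlying an \<open>Htilde\<close>-module: restriction of scalars along
  \<open>z \<mapsto> z \<cdot> 1\<close>.\<close>

definition complex_space ::
    "complex \<Rightarrow> complex \<Rightarrow> (free_alg set, 'v) module \<Rightarrow> (complex, 'v) module" where
  "complex_space r0 r1 V =
    \<lparr>carrier = carrier V, mult = mult V, one = one V, zero = zero V, add = add V,
     smult = (\<lambda>z v. Hclass r0 r1 (free_scalar z) \<odot>\<^bsub>V\<^esub> v)\<rparr>"

definition ordered_basis ::
    "complex \<Rightarrow> complex \<Rightarrow> (free_alg set, 'v) module \<Rightarrow> 'v list \<Rightarrow> bool" where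
  "ordered_basis r0 r1 V bs \<longleftrightarrow>
    distinct bs \<and> vectorspace.basis class_ring (complex_space r0 r1 V) (set bs)"

definition complex_span ::
    "complex \<Rightarrow> complex \<Rightarrow> (free_alg set, 'v) module \<Rightarrow> 'v set \<Rightarrow> 'v set" where
  "complex_span r0 r1 V S = LinearCombinations.module.span class_ring (complex_space r0 r1 V) S"

definition weight_space ::
    "complex \<Rightarrow> complex \<Rightarrow> (free_alg set, 'v) module \<Rightarrow> complex \<Rightarrow> complex \<Rightarrow> 'v set" where
  "weight_space r0 r1 V \<alpha> \<beta> =
    {v \<in> carrier V. HA r0 r1 \<odot>\<^bsub>V\<^esub> v = \<alpha> \<odot>\<^bsub>complex_space r0 r1 V\<^esub> v
                  \<and> HB r0 r1 \<odot>\<^bsub>V\<^esub> v = \<beta> \<odot>\<^bsub>complex_space r0 r1 V\<^esub> v}"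

definition preserves :: "('h, 'v) module \<Rightarrow> 'h \<Rightarrow> 'v set \<Rightarrow> bool" where
  "preserves V h W \<longleftrightarrow> (\<lambda>w. h \<odot>\<^bsub>V\<^esub> w) ` W \<subseteq> W"

text \<open>The list \<open>bs\<close> is \<open>a\<^sub>0, b\<^sub>0, a\<^sub>1, b\<^sub>1, \<dots>, a\<^sub>D\<close>. Having an ordered basis of
  length \<open>2 * D + 1\<close>, the module \<open>V\<close> has that dimension.\<close>

definition odd_adapted_block_basis ::
    "complex \<Rightarrow> complex \<Rightarrow> nat \<Rightarrow> (free_alg set, 'v) module \<Rightarrow> 'v list \<Rightarrow> bool" where
  "odd_adapted_block_basis r0 r1 D V bs \<longleftrightarrow>
    left_module (Htilde r0 r1) V \<and> length bs = 2 * D + 1 \<and> ordered_basis r0 r1 V bs \<and>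
    (let a = (\<lambda>i. bs ! (2 * i)); b = (\<lambda>i. bs ! (2 * i + 1));
         t0 = Hgen r0 r1 T0; t1 = Hgen r0 r1 T1; span = complex_span r0 r1 V in
     if D = 0 then \<exists>l0. l0 \<noteq> 0 \<and> a 0 \<in> weight_space r0 r1 V l0 0
     else \<exists>l m :: nat \<Rightarrow> complex.
       (\<forall>i\<le>D. l i \<noteq> 0) \<and> (\<forall>i<D. m i \<noteq> 0) \<and>
       (\<forall>i\<le>D. a i \<in> weight_space r0 r1 V (l i) 0) \<and>
       (\<forall>i<D. b i \<in> weight_space r0 r1 V 0 (m i)) \<and>
       preserves V t0 (span {a D}) \<and>
       preserves V t1 (span {a 0}) \<and>
       (\<forall>i<D. preserves V t0 (span {a i, b i})) \<and>
       (\<forall>i<D. preserves V t1 (span {b i, a (i + 1)})))"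


section \<open>The modules\<close>

definition kk :: "complex \<Rightarrow> complex" where
  "kk r = r + inverse r"

definition R_block :: "complex \<Rightarrow> complex \<Rightarrow> complex \<Rightarrow> complex mat" where
  "R_block r l c = mat_of_rows_list 2
    [[kk r - inverse l, - c * inverse l],
     [inverse c * (l - kk r + inverse l), inverse l]]"

definition P_block :: "complex \<Rightarrow> complex mat" where
  "P_block c = mat_of_rows_list 2 [[1, c], [0, 0]]"

definition S_block :: "complex \<Rightarrow> complex \<Rightarrow> complex mat" where
  "S_block r s = mat_of_rows_list 2 [[kk r, s], [- inverse s, 0]]"

definition N_block :: "complex \<Rightarrow> complex \<Rightarrow> complex mat" where
  "N_block s m = mat_of_rows_list 2 [[0, 0], [inverse s * m, 0]]"

definition scalar_block :: "complex \<Rightarrow> complex mat" where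
  "scalar_block z = mat_of_rows_list 1 [[z]]"

fun O_mat :: "complex \<Rightarrow> complex \<Rightarrow> nat \<Rightarrow> complex \<Rightarrow> complex \<Rightarrow>
    (nat \<Rightarrow> complex) \<Rightarrow> (nat \<Rightarrow> complex) \<Rightarrow> (nat \<Rightarrow> complex) \<Rightarrow> (nat \<Rightarrow> complex) \<Rightarrow> gen \<Rightarrow> complex mat"
where
  "O_mat r0 r1 D \<rho> \<sigma> c s lam mu T0 =
     diag_block_mat (map (\<lambda>i. R_block r0 (lam i) (c i)) [0..<D] @ [scalar_block \<rho>])"
| "O_mat r0 r1 D \<rho> \<sigma> c s lam mu U0 =
     diag_block_mat (map (\<lambda>i. P_block (c i)) [0..<D] @ [scalar_block 1])"
| "O_mat r0 r1 D \<rho> \<sigma> c s lam mu T1 =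
     diag_block_mat (scalar_block \<sigma> # map (\<lambda>i. S_block r1 (s i)) [0..<D])"
| "O_mat r0 r1 D \<rho> \<sigma> c s lam mu U1 =
     diag_block_mat (scalar_block 0 # map (\<lambda>i. N_block (s i) (mu i)) [0..<D])"

text \<open>The value of a noncommutative polynomial at an assignment \<open>X\<close> of \<open>n \<times> n\<close> matrices to the
  generators.\<close>

definition word_mat :: "nat \<Rightarrow> (gen \<Rightarrow> complex mat) \<Rightarrow> word \<Rightarrow> complex mat" where
  "word_mat n X w = foldr (\<lambda>g M. X g * M) (letters w) (1\<^sub>m n)"

definition free_eval :: "nat \<Rightarrow> (gen \<Rightarrow> complex mat) \<Rightarrow> free_alg \<Rightarrow> complex mat" where
  "free_eval n X p = mat n n (\<lambda>ij. \<Sum>w\<in>Poly_Mapping.keys p.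
     Poly_Mapping.lookup p w * word_mat n X w $$ ij)"

text \<open>The coordinate space of dimension \<open>n\<close>, on which a coset of the free algebra acts through
  the common value of \<^const>\<open>free_eval\<close> on its elements. As in \<^const>\<open>module_vec\<close>, the fields
  \<open>mult\<close> and \<open>one\<close> play no role.\<close>

definition matrix_module :: "nat \<Rightarrow> (gen \<Rightarrow> complex mat) \<Rightarrow> (free_alg set, complex vec) module" where
  "matrix_module n X =
    \<lparr>carrier = carrier_vec n, mult = undefined, one = undefined, zero = 0\<^sub>v n, add = (+),
     smult = (\<lambda>h v. the_elem (free_eval n X ` h) *\<^sub>v v)\<rparr>"

definition O_module :: "complex \<Rightarrow> complex \<Rightarrow> nat \<Rightarrow> complex \<Rightarrow> complex \<Rightarrow>
    (nat \<Rightarrow> complex) \<Rightarrow> (nat \<Rightarrow> complex) \<Rightarrow> (nat \<Rightarrow> complex) \<Rightarrow> (nat \<Rightarrow> complex) \<Rightarrow>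
    (free_alg set, complex vec) module" where
  "O_module r0 r1 D \<rho> \<sigma> c s lam mu = matrix_module (2 * D + 1) (O_mat r0 r1 D \<rho> \<sigma> c s lam mu)"

text \<open>The defining ordered basis of \<open>O_module\<close>: the \<open>2 * D + 1\<close> unit coordinate vectors.\<close>

definition O_basis :: "nat \<Rightarrow> complex vec list" where
  "O_basis D = unit_vecs (2 * D + 1)"

section \<open>Well-definedness of the modules\<close>

text \<open>Matrices satisfying the defining relations of \<open>Htilde\<close> make \<^const>\<open>matrix_module\<close> a left module
  on which the coset of \<open>p\<close> acts as \<open>free_eval n X p\<close>; the matrices \<^const>\<open>O_mat\<close> are such.\<close>

lemma letters_plus [simp]: "letters (u + v) = letters u @ letters v"
  by (simp add: plus_word_def)

lemma letters_zero [simp]: "letters 0 = []"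
  by (simp add: zero_word_def)

locale gen_mats =
  fixes n :: nat and X :: "gen \<Rightarrow> complex mat"
  assumes X_carrier [simp]: "X g \<in> carrier_mat n n"
begin

lemma foldr_carrier: "foldr (\<lambda>g M. X g * M) gs (1\<^sub>m n) \<in> carrier_mat n n"
  by (induction gs) (auto intro: mult_carrier_mat[OF X_carrier])

lemma word_mat_carrier [simp]: "word_mat n X w \<in> carrier_mat n n"
  unfolding word_mat_def by (rule foldr_carrier)

lemma word_mat_add: "word_mat n X (u + v) = word_mat n X u * word_mat n X v"
proof -
  have "foldr (\<lambda>g M. X g * M) (as @ bs) (1\<^sub>m n) =
      foldr (\<lambda>g M. X g * M) as (1\<^sub>m n) * foldr (\<lambda>g M. X g * M) bs (1\<^sub>m n)" for as bs
  proof (induction as)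
    case Nil
    show ?case using foldr_carrier[of bs] by simp
  next
    case (Cons a as)
    then show ?case
      using assoc_mult_mat[OF X_carrier foldr_carrier foldr_carrier] by simp
  qed
  then show ?thesis by (simp add: word_mat_def)
qed

lemma eval_carrier [simp]: "free_eval n X p \<in> carrier_mat n n"
  by (simp add: free_eval_def)

lemma eval_dim [simp]: "dim_row (free_eval n X p) = n" "dim_col (free_eval n X p) = n"
  by (simp_all add: free_eval_def)

lemma one_smult: "1 \<cdot>\<^sub>m A = (A :: complex mat)"
  by (rule eq_matI) auto

lemma eval_index: "i < n \<Longrightarrow> j < n \<Longrightarrow> free_eval n X p $$ (i, j) =
    (\<Sum>w\<in>Poly_Mapping.keys p. Poly_Mapping.lookup p w * word_mat n X w $$ (i, j))"
  by (simp add: free_eval_def)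

lemma eval_index_superset:
  assumes "i < n" "j < n" "finite W" "Poly_Mapping.keys p \<subseteq> W"
  shows "free_eval n X p $$ (i, j) = (\<Sum>w\<in>W. Poly_Mapping.lookup p w * word_mat n X w $$ (i, j))"
  unfolding eval_index[OF assms(1,2)]
  using assms by (intro sum.mono_neutral_left) (auto simp: in_keys_iff)

lemma eval_add: "free_eval n X (p + q) = free_eval n X p + free_eval n X q"
proof (rule eq_matI)
  fix i j assume "i < dim_row (free_eval n X p + free_eval n X q)" "j < dim_col (free_eval n X p + free_eval n X q)"
  then have ij: "i < n" "j < n" by (auto simp: free_eval_def)
  let ?W = "Poly_Mapping.keys p \<union> Poly_Mapping.keys q"
  have W: "finite ?W" "Poly_Mapping.keys p \<subseteq> ?W" "Poly_Mapping.keys q \<subseteq> ?W" "Poly_Mapping.keys (p + q) \<subseteq> ?W"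
    using Poly_Mapping.keys_add[of p q] by auto
  show "free_eval n X (p + q) $$ (i, j) = (free_eval n X p + free_eval n X q) $$ (i, j)"
    using ij by (simp add: eval_index_superset[OF ij W(1)] W lookup_add sum.distrib ring_distribs)
qed (auto simp: free_eval_def)

lemma eval_zero: "free_eval n X 0 = 0\<^sub>m n n"
  by (rule eq_matI) (auto simp: free_eval_def)

lemma eval_single: "free_eval n X (Poly_Mapping.single w z) = z \<cdot>\<^sub>m word_mat n X w"
  using word_mat_carrier[of w]
  by (intro eq_matI) (auto simp: free_eval_def simp del: word_mat_carrier)

lemma eval_uminus: "free_eval n X (- p) = - free_eval n X p"
  using eval_carrier[of p] by (intro eq_matI) (auto simp: free_eval_def sum_negf)

lemma eval_minus: "free_eval n X (p - q) = free_eval n X p - free_eval n X q"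
  using eval_add[of p "- q"] eval_carrier[of p] eval_carrier[of q]
  by (simp add: eval_uminus minus_add_uminus_mat[of _ n n])

lemma free_alg_induct [case_names zero single_add]:
  assumes "P 0" "\<And>w z p. P p \<Longrightarrow> P (Poly_Mapping.single w z + p)"
  shows "P (p :: free_alg)"
proof (induction p rule: update_induct)
  case const
  then show ?case using assms(1) by simp
next
  case (update f a b)
  have "Poly_Mapping.update a b f = Poly_Mapping.single a b + f"
    using update by (intro poly_mapping_eqI)
      (auto simp: lookup_update lookup_add lookup_single when_def in_keys_iff)
  then show ?case using assms(2)[OF update(3)] by simp
qed

lemma eval_mult: "free_eval n X (p * q) = free_eval n X p * free_eval n X q"
proof (induction p rule: free_alg_induct)
  case zero
  show ?case by (simp add: eval_zero left_mult_zero_mat[OF eval_carrier])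
next
  case (single_add w z p)
  have "free_eval n X (Poly_Mapping.single w z * q) = free_eval n X (Poly_Mapping.single w z) * free_eval n X q"
  proof (induction q rule: free_alg_induct)
    case zero
    show ?case by (simp add: eval_zero right_mult_zero_mat[OF eval_carrier])
  next
    case (single_add v y q)
    have "free_eval n X (Poly_Mapping.single w z * (Poly_Mapping.single v y)) =
        free_eval n X (Poly_Mapping.single w z) * free_eval n X (Poly_Mapping.single v y)"
      by (auto intro!: eq_matI simp: mult_single eval_single word_mat_add
          mult_smult_assoc_mat[OF word_mat_carrier smult_carrier_mat[OF word_mat_carrier]]
          mult_smult_distrib[OF word_mat_carrier word_mat_carrier] carrier_matD[OF word_mat_carrier])
    with single_add show ?case
      by (simp add: ring_distribs eval_add mult_add_distrib_mat[OF eval_carrier eval_carrier eval_carrier])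
  qed
  with single_add show ?case
    by (simp add: ring_distribs eval_add add_mult_distrib_mat[OF eval_carrier eval_carrier eval_carrier])
qed

lemma word_mat_zero: "word_mat n X 0 = 1\<^sub>m n"
  by (simp add: word_mat_def)

lemma eval_scalar: "free_eval n X (free_scalar z) = z \<cdot>\<^sub>m 1\<^sub>m n"
  by (simp add: free_scalar_def eval_single word_mat_zero)

lemma eval_one: "free_eval n X 1 = 1\<^sub>m n"
  using eval_scalar[of 1] by (simp add: free_scalar_def one_smult)

lemma eval_gen: "free_eval n X (free_gen g) = X g"
  by (simp add: free_gen_def eval_single word_mat_def one_smult right_mult_one_mat[OF X_carrier] right_mult_one_mat[of _ n n])

lemma eval_hom: "free_eval n X \<in> Ring.ring_hom free_ring (ring_mat TYPE(complex) n b)"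
  by (auto simp: Ring.ring_hom_def ring_mat_def eval_mult eval_add eval_one)

end

locale H_rep = gen_mats +
  fixes r0 r1 :: complex
  assumes rels: "p \<in> relators r0 r1 \<Longrightarrow> free_eval n X p = 0\<^sub>m n n"
begin

lemma ideal_rel: "ideal (rel_ideal r0 r1) free_ring"
  unfolding rel_ideal_def by (rule ring.genideal_ideal[OF class_ring.ring_axioms]) simp

lemma eval_rel_ideal: 
  assumes "p \<in> rel_ideal r0 r1" shows "free_eval n X p = 0\<^sub>m n n"
proof -
  let ?M = "ring_mat TYPE(complex) n ()"
  have hom: "ring_hom_ring free_ring ?M (free_eval n X)"
    by (rule ring_hom_ringI2[OF class_ring.ring_axioms ring_mat eval_hom])
  have "rel_ideal r0 r1 \<subseteq> a_kernel free_ring (ring_mat TYPE(complex) n ()) (free_eval n X)"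
    unfolding rel_ideal_def
    by (rule ring.genideal_minimal[OF class_ring.ring_axioms ring_hom_ring.kernel_is_ideal[OF hom]])
       (auto simp: a_kernel_def' rels ring_mat_def)
  with assms show ?thesis by (auto simp: a_kernel_def' ring_mat_def)
qed

lemma Hclass_eq: "Hclass r0 r1 p = {q + p | q. q \<in> rel_ideal r0 r1}"
  by (auto simp: Hclass_def a_r_coset_def')

lemma zero_rel: "0 \<in> rel_ideal r0 r1"
  using additive_subgroup.zero_closed[OF ideal.axioms(1)[OF ideal_rel]] by simp

lemma eval_class: "the_elem (free_eval n X ` Hclass r0 r1 p) = free_eval n X p"
proof -
  have "free_eval n X ` Hclass r0 r1 p = {free_eval n X p}"
  proof (intro equalityI subsetI)
    fix M assume "M \<in> free_eval n X ` Hclass r0 r1 p"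
    then obtain q where "q \<in> rel_ideal r0 r1" "M = free_eval n X (q + p)"
      unfolding Hclass_eq by blast
    then show "M \<in> {free_eval n X p}"
      by (simp add: eval_add eval_rel_ideal left_add_zero_mat[OF eval_carrier])
  next
    have "0 + p \<in> Hclass r0 r1 p" unfolding Hclass_eq using zero_rel by blast
    then show "M \<in> free_eval n X ` Hclass r0 r1 p" if "M \<in> {free_eval n X p}" for M
      using that by simp
  qed
  then show ?thesis by simp
qed

lemma smult_class: "Hclass r0 r1 p \<odot>\<^bsub>matrix_module n X\<^esub> v = free_eval n X p *\<^sub>v v"
  by (simp add: matrix_module_def eval_class)

lemma carrier_H: "h \<in> carrier (Htilde r0 r1) \<longleftrightarrow> (\<exists>p. h = Hclass r0 r1 p)"
  by (auto simp: Htilde_def FactRing_def A_RCOSETS_def' Hclass_def a_r_coset_def')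

lemma H_mult: "Hclass r0 r1 p \<otimes>\<^bsub>Htilde r0 r1\<^esub> Hclass r0 r1 q = Hclass r0 r1 (p * q)"
  using ideal.rcoset_mult_add[OF ideal_rel, of p q] by (simp add: Htilde_def FactRing_def Hclass_def)

lemma H_add: "Hclass r0 r1 p \<oplus>\<^bsub>Htilde r0 r1\<^esub> Hclass r0 r1 q = Hclass r0 r1 (p + q)"
  using abelian_subgroup.a_rcos_sum[OF abelian_subgroupI3[OF ideal.axioms(1)[OF ideal_rel] class_ring.abelian_group_axioms], of p q] by (simp add: Htilde_def FactRing_def Hclass_def)

lemma H_one: "\<one>\<^bsub>Htilde r0 r1\<^esub> = Hclass r0 r1 1"
  by (simp add: Htilde_def FactRing_def Hclass_def)

lemma vec_abelian: "abelian_group \<lparr>carrier = carrier_vec n :: complex vec set, mult = g, one = e, zero = 0\<^sub>v n, add = (+), smult = f\<rparr>"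
  apply (rule abelian_groupI)
  subgoal by simp
  subgoal by simp
  subgoal for x y z by (simp add: assoc_add_vec[of x n y z])
  subgoal for x y by (simp add: comm_add_vec[of x n y])
  subgoal by simp
  subgoal for x by (rule bexI[of _ "- x"]) simp_all
  done

lemma matrix_module_left_module: "left_module (Htilde r0 r1) (matrix_module n X)"
proof -
  have ag: "abelian_group (matrix_module n X)"
    using vec_abelian
    by (simp add: matrix_module_def)
  have r: "ring (Htilde r0 r1)"
    unfolding Htilde_def by (rule ideal.quotient_is_ring[OF ideal_rel])
  show ?thesis
  proof (intro left_module.intro r ag left_module_axioms.intro, goal_cases)
    case (1 a x)
    then show ?case
      by (auto simp: carrier_H smult_class) (simp add: matrix_module_def mult_mat_vec_carrier[OF eval_carrier])
  next
    case (2 a b x)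
    then show ?case
      by (auto simp: carrier_H smult_class H_add eval_add)
        (simp add: matrix_module_def add_mult_distrib_mat_vec[OF eval_carrier eval_carrier])
  next
    case (3 a x y)
    then show ?case
      by (auto simp: carrier_H smult_class)
        (simp add: matrix_module_def mult_add_distrib_mat_vec[OF eval_carrier] smult_class[unfolded matrix_module_def, simplified])
  next
    case (4 a b x)
    then show ?case
      by (auto simp: carrier_H smult_class H_mult eval_mult)
        (simp add: matrix_module_def assoc_mult_mat_vec[OF eval_carrier eval_carrier])
  next
    case (5 x)
    then show ?case
      by (auto simp: H_one smult_class eval_one) (simp add: matrix_module_def)
  qed
qed

end

abbreviation same_square :: "complex mat \<Rightarrow> complex mat \<Rightarrow> bool" where
  "same_square A B \<equiv> (\<exists>k. A \<in> carrier_mat k k \<and> B \<in> carrier_mat k k)"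

lemma diag_block_dims:
  assumes "list_all2 same_square As Bs"
  shows "\<exists>k. diag_block_mat As \<in> carrier_mat k k \<and> diag_block_mat Bs \<in> carrier_mat k k"
  using assms
proof (induction rule: list_all2_induct)
  case (Cons A As B Bs)
  then obtain k k' where k: "A \<in> carrier_mat k k" "B \<in> carrier_mat k k" "diag_block_mat As \<in> carrier_mat k' k'" "diag_block_mat Bs \<in> carrier_mat k' k'"
    by blast
  then show ?case
    by (intro exI[of _ "k + k'"]) (auto simp: Let_def)
next
  case Nil
  show ?case by (intro exI[of _ 0]) simp
qed

lemma diag_block_mult:
  assumes "list_all2 same_square As Bs"
  shows "diag_block_mat As * diag_block_mat Bs = diag_block_mat (map2 (*) As Bs)"
  using assms
proof (induction rule: list_all2_induct)
  case (Cons A As B Bs)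
  obtain k where k: "A \<in> carrier_mat k k" "B \<in> carrier_mat k k"
    using Cons by blast
  obtain k' where k': "diag_block_mat As \<in> carrier_mat k' k'" "diag_block_mat Bs \<in> carrier_mat k' k'"
    using diag_block_dims[OF Cons(2)] by blast
  have p: "diag_block_mat (map2 (*) As Bs) \<in> carrier_mat k' k'"
    using Cons(3) k' by (metis mult_carrier_mat)
  have "diag_block_mat (A # As) * diag_block_mat (B # Bs) =
     four_block_mat A (0\<^sub>m k k') (0\<^sub>m k' k) (diag_block_mat As) *
     four_block_mat B (0\<^sub>m k k') (0\<^sub>m k' k) (diag_block_mat Bs)"
    using k k' by (simp add: Let_def)
  also have "\<dots> = four_block_mat (A * B) (0\<^sub>m k k') (0\<^sub>m k' k) (diag_block_mat As * diag_block_mat Bs)"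
    using k k' by (subst mult_four_block_mat[of _ k k _ k' _ k' _ _ k _ k']) 
      (auto simp: right_mult_zero_mat[of _ _ k] left_add_zero_mat[of _ k' k'] right_add_zero_mat[of _ k k])
  also have "\<dots> = diag_block_mat (map2 (*) (A # As) (B # Bs))"
    using k p Cons(3) by (simp add: Let_def)
  finally show ?case .
qed auto

lemma diag_block_minus:
  assumes "list_all2 same_square As Bs"
  shows "diag_block_mat As - diag_block_mat Bs = diag_block_mat (map2 (-) As Bs)"
  using assms
proof (induction rule: list_all2_induct)
  case (Cons A As B Bs)
  obtain k where k: "A \<in> carrier_mat k k" "B \<in> carrier_mat k k"
    using Cons by blast
  obtain k' where k': "diag_block_mat As \<in> carrier_mat k' k'" "diag_block_mat Bs \<in> carrier_mat k' k'"
    using diag_block_dims[OF Cons(2)] by blast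
  have p: "diag_block_mat (map2 (-) As Bs) \<in> carrier_mat k' k'"
    using Cons(3) k' by (metis minus_carrier_mat)
  have "diag_block_mat (A # As) - diag_block_mat (B # Bs) =
     four_block_mat A (0\<^sub>m k k') (0\<^sub>m k' k) (diag_block_mat As) -
     four_block_mat B (0\<^sub>m k k') (0\<^sub>m k' k) (diag_block_mat Bs)"
    using k k' by (simp add: Let_def)
  also have "\<dots> = four_block_mat (A - B) (0\<^sub>m k k') (0\<^sub>m k' k) (diag_block_mat As - diag_block_mat Bs)"
    using k k' by (intro eq_matI) auto
  also have "\<dots> = diag_block_mat (map2 (-) (A # As) (B # Bs))"
    using k p Cons(3) by (simp add: Let_def)
  finally show ?case .
qed auto

lemma diag_block_scalar:
  "diag_block_mat (map (\<lambda>A. z \<cdot>\<^sub>m 1\<^sub>m (dim_row A)) As) = (z::complex) \<cdot>\<^sub>m 1\<^sub>m (sum_list (map dim_row As))"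
  by (induction As) (auto simp: Let_def intro!: eq_matI)

lemma diag_block_zero:
  assumes "\<forall>A\<in>set As. \<exists>k. A = 0\<^sub>m k k"
  shows "\<exists>k. diag_block_mat As = (0\<^sub>m k k :: complex mat)"
  using assms
proof (induction As)
  case (Cons A As)
  then obtain k k' where "A = 0\<^sub>m k k" "diag_block_mat As = 0\<^sub>m k' k'" by auto
  then have "diag_block_mat (A # As) = 0\<^sub>m (k + k') (k + k')"
    by (auto simp: Let_def intro!: eq_matI)
  then show ?case by blast
qed auto

lemma diag_block_quadratic:
  assumes sq: "\<forall>A\<in>set As. square_mat A"
    and q: "\<forall>A\<in>set As. (A - x \<cdot>\<^sub>m 1\<^sub>m (dim_row A)) * (A - y \<cdot>\<^sub>m 1\<^sub>m (dim_row A)) = 0\<^sub>m (dim_row A) (dim_row A)"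
    and n: "n = sum_list (map dim_row As)"
  shows "(diag_block_mat As - x \<cdot>\<^sub>m 1\<^sub>m n) * (diag_block_mat As - y \<cdot>\<^sub>m 1\<^sub>m n) = (0\<^sub>m n n :: complex mat)"
proof -
  have d: "diag_block_mat As - z \<cdot>\<^sub>m 1\<^sub>m n = diag_block_mat (map (\<lambda>A. A - z \<cdot>\<^sub>m 1\<^sub>m (dim_row A)) As)" for z
  proof -
    have "list_all2 same_square As (map (\<lambda>A. z \<cdot>\<^sub>m 1\<^sub>m (dim_row A)) As)"
      using sq by (auto simp: list_all2_conv_all_nth square_mat.simps intro!: exI[of _ "dim_row (As ! i)" for i] carrier_matI)
    from diag_block_minus[OF this] show ?thesis
      by (simp add: diag_block_scalar n map2_map_map[of "(-)" "\<lambda>A. A", simplified])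
  qed
  have "list_all2 same_square (map (\<lambda>A. A - x \<cdot>\<^sub>m 1\<^sub>m (dim_row A)) As) (map (\<lambda>A. A - y \<cdot>\<^sub>m 1\<^sub>m (dim_row A)) As)"
    by (auto simp: list_all2_conv_all_nth intro!: exI[of _ "dim_row (As ! i)" for i])
  from diag_block_mult[OF this] have e: "(diag_block_mat As - x \<cdot>\<^sub>m 1\<^sub>m n) * (diag_block_mat As - y \<cdot>\<^sub>m 1\<^sub>m n) =
     diag_block_mat (map (\<lambda>A. (A - x \<cdot>\<^sub>m 1\<^sub>m (dim_row A)) * (A - y \<cdot>\<^sub>m 1\<^sub>m (dim_row A))) As)"
    by (simp add: d map2_map_map)
  obtain k where k: "diag_block_mat (map (\<lambda>A. (A - x \<cdot>\<^sub>m 1\<^sub>m (dim_row A)) * (A - y \<cdot>\<^sub>m 1\<^sub>m (dim_row A))) As) = 0\<^sub>m k k"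
    using diag_block_zero[of "map (\<lambda>A. (A - x \<cdot>\<^sub>m 1\<^sub>m (dim_row A)) * (A - y \<cdot>\<^sub>m 1\<^sub>m (dim_row A))) As"] q by auto
  have "dim_row (diag_block_mat (map (\<lambda>A. (A - x \<cdot>\<^sub>m 1\<^sub>m (dim_row A)) * (A - y \<cdot>\<^sub>m 1\<^sub>m (dim_row A))) As)) = n"
    by (simp add: dim_diag_block_mat n o_def)
  with k have "k = n" by (metis index_zero_mat(2))
  with e k show ?thesis by simp
qed


lemma mat2_eqI:
  assumes "A \<in> carrier_mat 2 2" "B \<in> carrier_mat 2 2"
    "A $$ (0,0) = B $$ (0,0)" "A $$ (0,1) = B $$ (0,1)" "A $$ (1,0) = B $$ (1,0)" "A $$ (1,1) = B $$ (1,1)"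
  shows "A = B"
  using assms by (intro eq_matI) (auto simp: less_2_cases_iff)

lemma mat2_mult:
  assumes "A \<in> carrier_mat 2 2" "B \<in> carrier_mat 2 2" "i < 2" "j < 2"
  shows "(A * B) $$ (i, j) = A $$ (i,0) * B $$ (0,j) + A $$ (i,1) * (B $$ (1,j) :: complex)"
  using assms by (simp add: scalar_prod_def numeral_2_eq_2)

lemma block_carrier [simp]:
  "R_block r l c \<in> carrier_mat 2 2" "P_block c \<in> carrier_mat 2 2" "S_block r s \<in> carrier_mat 2 2"
  "N_block s m \<in> carrier_mat 2 2" "scalar_block z \<in> carrier_mat 1 1"
  by (auto simp: R_block_def P_block_def S_block_def N_block_def scalar_block_def mat_of_rows_list_def)

lemma block_dim [simp]:
  "dim_row (R_block r l c) = 2" "dim_row (P_block c) = 2" "dim_row (S_block r s) = 2"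
  "dim_row (N_block s m) = 2" "dim_row (scalar_block z) = 1"
  "dim_col (R_block r l c) = 2" "dim_col (P_block c) = 2" "dim_col (S_block r s) = 2"
  "dim_col (N_block s m) = 2" "dim_col (scalar_block z) = 1"
  by (auto simp: R_block_def P_block_def S_block_def N_block_def scalar_block_def mat_of_rows_list_def)

lemma block_index:
  "R_block r l c $$ (0,0) = kk r - inverse l" "R_block r l c $$ (0,Suc 0) = - c * inverse l"
  "R_block r l c $$ (Suc 0,0) = inverse c * (l - kk r + inverse l)" "R_block r l c $$ (Suc 0,Suc 0) = inverse l"
  "P_block c $$ (0,0) = 1" "P_block c $$ (0,Suc 0) = c" "P_block c $$ (Suc 0,0) = 0" "P_block c $$ (Suc 0,Suc 0) = 0"
  "S_block r s $$ (0,0) = kk r" "S_block r s $$ (0,Suc 0) = s" "S_block r s $$ (Suc 0,0) = - inverse s" "S_block r s $$ (Suc 0,Suc 0) = 0"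
  "N_block s m $$ (0,0) = 0" "N_block s m $$ (0,Suc 0) = 0" "N_block s m $$ (Suc 0,0) = inverse s * m" "N_block s m $$ (Suc 0,Suc 0) = 0"
  "scalar_block z $$ (0,0) = z"
  by (simp_all add: R_block_def P_block_def S_block_def N_block_def scalar_block_def mat_of_rows_list_def)

lemma R_quad:
  assumes "r \<noteq> 0" "l \<noteq> 0" "c \<noteq> 0"
  shows "(R_block r l c - r \<cdot>\<^sub>m 1\<^sub>m 2) * (R_block r l c - inverse r \<cdot>\<^sub>m 1\<^sub>m 2) = 0\<^sub>m 2 2"
proof -
  have c: "R_block r l c - z \<cdot>\<^sub>m 1\<^sub>m 2 \<in> carrier_mat 2 2" for z by (rule minus_carrier_mat) simp
  show ?thesis
    by (rule mat2_eqI; simp add: mat2_mult[OF c c] mult_carrier_mat[OF c c] block_index kk_def del: index_mult_mat(1))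
      (use assms in \<open>simp_all add: field_simps\<close>)
qed

lemma S_quad:
  assumes "r \<noteq> 0" "s \<noteq> 0"
  shows "(S_block r s - r \<cdot>\<^sub>m 1\<^sub>m 2) * (S_block r s - inverse r \<cdot>\<^sub>m 1\<^sub>m 2) = 0\<^sub>m 2 2"
proof -
  have c: "S_block r s - z \<cdot>\<^sub>m 1\<^sub>m 2 \<in> carrier_mat 2 2" for z by (rule minus_carrier_mat) simp
  show ?thesis
    by (rule mat2_eqI; simp add: mat2_mult[OF c c] mult_carrier_mat[OF c c] block_index kk_def del: index_mult_mat(1))
      (use assms in \<open>simp_all add: field_simps\<close>)
qed

lemma scalar_quad:
  assumes "x \<in> {r, inverse r}"
  shows "(scalar_block x - r \<cdot>\<^sub>m 1\<^sub>m 1) * (scalar_block x - inverse r \<cdot>\<^sub>m 1\<^sub>m 1) = 0\<^sub>m 1 1"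
  using assms
  by (intro eq_matI) (auto simp: scalar_prod_def block_index)

lemma P_idem: "P_block c * P_block c = P_block c"
  by (intro mat2_eqI) (auto simp del: index_mult_mat(1) simp: mat2_mult block_index)

lemma N_nil: "N_block s m * N_block s m = 0\<^sub>m 2 2"
  by (intro mat2_eqI) (auto simp del: index_mult_mat(1) simp: mat2_mult block_index)

definition corner :: "complex \<Rightarrow> complex mat" where
  "corner z = mat 2 2 (\<lambda>(i,j). if i = 0 \<and> j = 0 then z else 0)"

lemma corner_dim [simp]: "dim_row (corner z) = 2" "dim_col (corner z) = 2" "corner z \<in> carrier_mat 2 2"
  by (auto simp: corner_def)

lemma PR: "l \<noteq> 0 \<Longrightarrow> c \<noteq> 0 \<Longrightarrow> P_block c * R_block r l c = corner l"
  by (intro mat2_eqI) (auto simp del: index_mult_mat(1) simp: mat2_mult block_index corner_def field_simps)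

lemma SN: "s \<noteq> 0 \<Longrightarrow> S_block r s * N_block s m = corner m"
  by (intro mat2_eqI) (auto simp del: index_mult_mat(1) simp: mat2_mult block_index corner_def field_simps)

lemma scalar_mult: "scalar_block x * scalar_block y = scalar_block (x * y)"
  by (intro eq_matI) (auto simp: scalar_prod_def block_index)

definition even_diag :: "complex mat \<Rightarrow> bool" where
  "even_diag M \<longleftrightarrow> square_mat M \<and> (\<forall>i<dim_row M. \<forall>j<dim_row M. M $$ (i,j) \<noteq> 0 \<longrightarrow> i = j \<and> even i)"

definition odd_diag :: "complex mat \<Rightarrow> bool" where
  "odd_diag M \<longleftrightarrow> square_mat M \<and> (\<forall>i<dim_row M. \<forall>j<dim_row M. M $$ (i,j) \<noteq> 0 \<longrightarrow> i = j \<and> odd i)"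

lemma even_diag_corner_Cons: "even_diag M \<Longrightarrow> even_diag (four_block_mat (corner z) (0\<^sub>m (dim_row (corner z)) (dim_col M)) (0\<^sub>m (dim_row M) (dim_col (corner z))) M)" (is "_ \<Longrightarrow> even_diag ?F")
proof -
  assume M: "even_diag M"
  have "i = j \<and> even i" if "i < 2 + dim_row M" "j < 2 + dim_row M"
    "four_block_mat (corner z) (0\<^sub>m 2 (dim_col M)) (0\<^sub>m (dim_row M) 2) M $$ (i, j) \<noteq> 0" for i j
  proof (cases "i < 2 \<or> j < 2")
    case True
    then show ?thesis using that M by (auto simp: corner_def even_diag_def split: if_splits)
  next
    case False
    then obtain i' j' where "i = i' + 2" "j = j' + 2"
      by (metis add.commute le_Suc_ex not_less)
    then show ?thesis using that M by (auto simp: even_diag_def)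
  qed
  note * = this
  have d: "dim_row ?F = 2 + dim_row M" "square_mat ?F" using M by (simp_all add: even_diag_def)
  show "even_diag ?F" unfolding even_diag_def d(1) using d(2) * unfolding corner_dim by blast
qed

lemma even_diag_corners:
  assumes "even_diag (diag_block_mat Ms)"
  shows "even_diag (diag_block_mat (map (\<lambda>i. corner (f i)) is @ Ms))"
proof (induction "is")
  case Nil show ?case using assms by simp
next
  case (Cons i "is")
  from even_diag_corner_Cons[OF this, of "f i"] show ?case by (simp add: Let_def)
qed

lemma even_diag_A: "even_diag (diag_block_mat (map (\<lambda>i. corner (f i)) is @ [scalar_block z]))"
  by (rule even_diag_corners) (simp add: even_diag_def block_index)

lemma odd_diag_Cons:
  assumes M: "even_diag M"
  shows "odd_diag (four_block_mat (scalar_block 0) (0\<^sub>m 1 (dim_col M)) (0\<^sub>m (dim_row M) 1) M)" (is "odd_diag ?F")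
proof -
  have "i = j \<and> odd i" if "i < 1 + dim_row M" "j < 1 + dim_row M" "?F $$ (i, j) \<noteq> 0" for i j
  proof (cases "i = 0 \<or> j = 0")
    case True
    then show ?thesis using that M by (auto simp: block_index even_diag_def split: if_splits)
  next
    case False
    then obtain i' j' where "i = i' + 1" "j = j' + 1"
      by (metis Suc_eq_plus1 not0_implies_Suc)
    then show ?thesis using that M by (auto simp: even_diag_def)
  qed
  note * = this
  have d: "dim_row ?F = 1 + dim_row M" "square_mat ?F" using M by (simp_all add: even_diag_def)
  show ?thesis unfolding odd_diag_def d(1) using d(2) * by blast
qed

lemma odd_diag_B: "odd_diag (diag_block_mat (scalar_block 0 # map (\<lambda>i. corner (f i)) is))"
proof -
  have "even_diag (diag_block_mat (map (\<lambda>i. corner (f i)) is @ []))"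
    by (rule even_diag_corners) (simp add: even_diag_def)
  from odd_diag_Cons[OF this] show ?thesis
    by (simp add: Let_def)
qed

lemma even_odd_zero:
  assumes "even_diag A" "odd_diag B" "dim_row A = n" "dim_row B = n"
  shows "A * B = 0\<^sub>m n n" "B * A = 0\<^sub>m n n"
proof -
  have d: "dim_row A = n" "dim_col A = n" "dim_row B = n" "dim_col B = n"
    using assms by (simp_all add: even_diag_def odd_diag_def)
  have a: "A $$ (i, x) = 0" if "i < n" "x < n" "odd i \<or> odd x" for i x
    using assms(1) that unfolding even_diag_def d by blast
  have b: "B $$ (i, x) = 0" if "i < n" "x < n" "even i \<or> even x" for i x
    using assms(2) that unfolding odd_diag_def d by blast
  have ab: "A $$ (i, x) * B $$ (x, j) = 0" "B $$ (i, x) * A $$ (x, j) = 0" if "i < n" "j < n" "x < n" for i j x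
    using a[of i x] b[of x j] b[of i x] a[of x j] that by (cases "even x"; simp)+
  show "A * B = 0\<^sub>m n n" "B * A = 0\<^sub>m n n"
    by (rule eq_matI; simp add: d scalar_prod_def ab)+
qed

lemma O_mat_carrier: "O_mat r0 r1 D \<rho> \<sigma> c s lam mu g \<in> carrier_mat (2 * D + 1) (2 * D + 1)"
proof -
  have "dim_row (diag_block_mat (map f [0..<D] @ [scalar_block z])) = 2 * D + 1"
    "dim_col (diag_block_mat (map f [0..<D] @ [scalar_block z])) = 2 * D + 1"
    "dim_row (diag_block_mat (scalar_block z # map f [0..<D])) = 2 * D + 1"
    "dim_col (diag_block_mat (scalar_block z # map f [0..<D])) = 2 * D + 1"
    if "\<And>i. f i \<in> carrier_mat 2 2" for f z
    unfolding dim_diag_block_mat using that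
    by (simp_all add: o_def carrier_matD[OF that] sum_list_triv)
  then show ?thesis
    by (cases g) (simp_all only: O_mat.simps carrier_mat_def mem_Collect_eq block_carrier[unfolded carrier_mat_def mem_Collect_eq])
qed

lemma map2_same: "map2 h (map f xs) (map g xs) = map (\<lambda>x. h (f x) (g x)) xs"
  by (induction xs) simp_all

lemma map2_same_snoc: "map2 h (map f xs @ [a]) (map g xs @ [b]) = map (\<lambda>x. h (f x) (g x)) xs @ [h a b]"
  by (induction xs) simp_all

lemma same_square_lists:
  assumes "\<And>i. f i \<in> carrier_mat 2 2" "\<And>i. g i \<in> carrier_mat 2 2" "a \<in> carrier_mat 1 1" "b \<in> carrier_mat 1 1"
  shows "list_all2 same_square (map f xs @ [a]) (map g xs @ [b])"
    "list_all2 same_square (a # map f xs) (b # map g xs)"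
proof -
  have m: "list_all2 same_square (map f xs) (map g xs)"
    by (induction xs) (use assms(1,2) in \<open>auto intro!: exI[of _ 2]\<close>)
  moreover have "same_square a b" using assms(3,4) by blast
  ultimately show "list_all2 same_square (map f xs @ [a]) (map g xs @ [b])"
    "list_all2 same_square (a # map f xs) (b # map g xs)"
    by (auto intro!: list_all2_appendI simp del: ex_simps)
qed

lemma O_mat_rels:
  fixes D :: nat and r0 r1 \<rho> \<sigma> :: complex and c s lam mu :: "nat \<Rightarrow> complex"
  assumes a: "r0 \<noteq> 0" "r1 \<noteq> 0" "\<rho> \<in> {r0, inverse r0}" "\<sigma> \<in> {r1, inverse r1}"
    "\<forall>i<D. c i \<noteq> 0" "\<forall>i<D. s i \<noteq> 0" "\<forall>i<D. lam i \<noteq> 0" "\<forall>i<D. mu i \<noteq> 0"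
  shows "H_rep (2 * D + 1) (O_mat r0 r1 D \<rho> \<sigma> c s lam mu) r0 r1"
proof -
  let ?X = "O_mat r0 r1 D \<rho> \<sigma> c s lam mu"
  let ?n = "2 * D + 1"
  interpret G: gen_mats ?n ?X
    by unfold_locales (rule O_mat_carrier)
  note X = O_mat_carrier[of r0 r1 D \<rho> \<sigma> c s lam mu]
  have Rq: "(R_block r0 (lam i) (c i) - r0 \<cdot>\<^sub>m 1\<^sub>m 2) * (R_block r0 (lam i) (c i) - inverse r0 \<cdot>\<^sub>m 1\<^sub>m 2) = 0\<^sub>m 2 2"
    and Sq: "(S_block r1 (s i) - r1 \<cdot>\<^sub>m 1\<^sub>m 2) * (S_block r1 (s i) - inverse r1 \<cdot>\<^sub>m 1\<^sub>m 2) = 0\<^sub>m 2 2" if "i < D" for i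
    using a that by (intro R_quad S_quad; blast)+
  note sq = scalar_quad[OF a(3)] scalar_quad[OF a(4)]
  have t0: "(?X T0 - r0 \<cdot>\<^sub>m 1\<^sub>m ?n) * (?X T0 - inverse r0 \<cdot>\<^sub>m 1\<^sub>m ?n) = 0\<^sub>m ?n ?n"
    unfolding O_mat.simps
  proof (rule diag_block_quadratic)
    show "?n = sum_list (map dim_row (map (\<lambda>i. R_block r0 (lam i) (c i)) [0..<D] @ [scalar_block \<rho>]))"
      by (simp add: o_def sum_list_triv)
  qed (auto simp only: set_append set_map set_simps set_upt atLeastLessThan_iff Un_iff insert_iff empty_iff
      ball_Un ball_simps block_dim square_mat.simps Rq sq)
  have t1: "(?X T1 - r1 \<cdot>\<^sub>m 1\<^sub>m ?n) * (?X T1 - inverse r1 \<cdot>\<^sub>m 1\<^sub>m ?n) = 0\<^sub>m ?n ?n"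
    unfolding O_mat.simps
  proof (rule diag_block_quadratic)
    show "?n = sum_list (map dim_row (scalar_block \<sigma> # map (\<lambda>i. S_block r1 (s i)) [0..<D]))"
      by (simp add: o_def sum_list_triv)
  qed (auto simp only: set_append list.map set_map set_simps set_upt atLeastLessThan_iff Un_iff insert_iff empty_iff
      ball_Un ball_simps block_dim square_mat.simps Sq sq)
  have u0: "?X U0 * ?X U0 = ?X U0"
    unfolding O_mat.simps
    by (subst diag_block_mult[OF same_square_lists(1)], (rule block_carrier)+)
      (simp only: map2_same_snoc P_idem scalar_mult mult_1)
  have "?X U1 * ?X U1 = diag_block_mat ((scalar_block 0 * scalar_block 0) # map (\<lambda>i. 0\<^sub>m 2 2) [0..<D])"
    unfolding O_mat.simps
    by (subst diag_block_mult[OF same_square_lists(2)], (rule block_carrier)+)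
      (simp only: list.simps zip_Cons_Cons prod.case map2_same N_nil)
  moreover have "scalar_block 0 * scalar_block 0 = 0\<^sub>m 1 1"
    by (intro eq_matI) (auto simp: scalar_prod_def block_index)
  moreover have "\<exists>k. diag_block_mat (0\<^sub>m 1 1 # map (\<lambda>i. 0\<^sub>m 2 2) [0..<D]) = (0\<^sub>m k k :: complex mat)"
    by (rule diag_block_zero) auto
  ultimately obtain k where k: "?X U1 * ?X U1 = 0\<^sub>m k k"
    by (elim exE) (simp only:)
  have "dim_row (?X U1 * ?X U1) = ?n"
    using X[of U1] by (simp only: index_mult_mat carrier_matD)
  then have "k = ?n" unfolding k by (simp only: index_zero_mat)
  with k have u1: "?X U1 * ?X U1 = 0\<^sub>m ?n ?n" by (simp only:)
  have PRs: "map (\<lambda>i. P_block (c i) * R_block r0 (lam i) (c i)) [0..<D] = map (\<lambda>i. corner (lam i)) [0..<D]"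
    and SNs: "map (\<lambda>i. S_block r1 (s i) * N_block (s i) (mu i)) [0..<D] = map (\<lambda>i. corner (mu i)) [0..<D]"
    using a by (simp_all add: PR SN)
  have A: "?X U0 * ?X T0 = diag_block_mat (map (\<lambda>i. corner (lam i)) [0..<D] @ [scalar_block \<rho>])"
    unfolding O_mat.simps
    by (subst diag_block_mult[OF same_square_lists(1)], (rule block_carrier)+)
      (simp only: map2_same_snoc scalar_mult mult_1 PRs)
  have B: "?X T1 * ?X U1 = diag_block_mat (scalar_block 0 # map (\<lambda>i. corner (mu i)) [0..<D])"
    unfolding O_mat.simps
    by (subst diag_block_mult[OF same_square_lists(2)], (rule block_carrier)+)
      (simp only: list.simps zip_Cons_Cons prod.case map2_same scalar_mult mult_zero_right SNs)
  have dims: "dim_row (?X U0 * ?X T0) = ?n" "dim_row (?X T1 * ?X U1) = ?n"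
    by (simp_all only: index_mult_mat carrier_matD[OF X])
  have e: "even_diag (?X U0 * ?X T0)" and o: "odd_diag (?X T1 * ?X U1)"
    unfolding A B by (rule even_diag_A odd_diag_B)+
  have AB: "(?X U0 * ?X T0) * (?X T1 * ?X U1) = 0\<^sub>m ?n ?n" "(?X T1 * ?X U1) * (?X U0 * ?X T0) = 0\<^sub>m ?n ?n"
    by (rule even_odd_zero[OF e o dims])+
  have assoc: "a * b * c' * d = (a * b) * (c' * d)"
    if "a \<in> carrier_mat ?n ?n" "b \<in> carrier_mat ?n ?n" "c' \<in> carrier_mat ?n ?n" "d \<in> carrier_mat ?n ?n" for a b c' d :: "complex mat"
    using that by (intro assoc_mult_mat[of "a * b" ?n ?n c' ?n d ?n] mult_carrier_mat[of a ?n ?n b ?n])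
  note ev = G.eval_mult G.eval_minus G.eval_gen G.eval_scalar
  have u00: "?X U0 - ?X U0 = 0\<^sub>m ?n ?n"
    using X[of U0] by (rule minus_r_inv_mat)
  let ?P = "\<lambda>p. free_eval ?n ?X p = 0\<^sub>m ?n ?n"
  have 1: "?P ((free_gen T0 - free_scalar r0) * (free_gen T0 - free_scalar (inverse r0)))"
    unfolding ev by (rule t0)
  have 2: "?P ((free_gen T1 - free_scalar r1) * (free_gen T1 - free_scalar (inverse r1)))"
    unfolding ev by (rule t1)
  have 3: "?P (free_gen U0 * free_gen U0 - free_gen U0)"
    unfolding ev u0 by (rule u00)
  have 4: "?P (free_gen U1 * free_gen U1)"
    unfolding ev by (rule u1)
  have 5: "?P (free_gen U0 * free_gen T0 * free_gen T1 * free_gen U1)"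
    unfolding ev assoc[OF X X X X] by (rule AB(1))
  have 6: "?P (free_gen T1 * free_gen U1 * free_gen U0 * free_gen T0)"
    unfolding ev assoc[OF X X X X] by (rule AB(2))
  have "\<forall>p\<in>relators r0 r1. ?P p"
    unfolding relators_def Let_def ball_simps by (intro conjI TrueI 1 2 3 4 5 6)
  then have "H_rep_axioms ?n ?X r0 r1" unfolding H_rep_axioms_def by (intro allI impI) (erule bspec)
  then show ?thesis by (intro H_rep.intro G.gen_mats_axioms)
qed

lemma scalar_mat_vec: "v \<in> carrier_vec n \<Longrightarrow> (z \<cdot>\<^sub>m 1\<^sub>m n) *\<^sub>v v = (z::complex) \<cdot>\<^sub>v v"
  by (rule eq_vecI) (simp_all add: smult_scalar_prod_distrib[OF unit_vec_carrier] scalar_prod_left_unit)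

lemma O_module_left_module:
  fixes D :: nat and r0 r1 \<rho> \<sigma> :: complex and c s lam mu :: "nat \<Rightarrow> complex"
  assumes "r0 \<noteq> 0" "r1 \<noteq> 0" "\<rho> \<in> {r0, inverse r0}" "\<sigma> \<in> {r1, inverse r1}"
    "\<forall>i<D. c i \<noteq> 0" "\<forall>i<D. s i \<noteq> 0" "\<forall>i<D. lam i \<noteq> 0" "\<forall>i<D. mu i \<noteq> 0"
  shows "left_module (Htilde r0 r1) (O_module r0 r1 D \<rho> \<sigma> c s lam mu)"
    and "Hgen r0 r1 g \<odot>\<^bsub>O_module r0 r1 D \<rho> \<sigma> c s lam mu\<^esub> v = O_mat r0 r1 D \<rho> \<sigma> c s lam mu g *\<^sub>v v"
    and "v \<in> carrier_vec (2*D+1) \<Longrightarrow> z \<odot>\<^bsub>complex_space r0 r1 (O_module r0 r1 D \<rho> \<sigma> c s lam mu)\<^esub> v = z \<cdot>\<^sub>v v"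
proof -
  interpret H_rep "2 * D + 1" "O_mat r0 r1 D \<rho> \<sigma> c s lam mu" r0 r1
    by (rule O_mat_rels[OF assms])
  show "left_module (Htilde r0 r1) (O_module r0 r1 D \<rho> \<sigma> c s lam mu)"
    unfolding O_module_def by (rule matrix_module_left_module)
  show "Hgen r0 r1 g \<odot>\<^bsub>O_module r0 r1 D \<rho> \<sigma> c s lam mu\<^esub> v = O_mat r0 r1 D \<rho> \<sigma> c s lam mu g *\<^sub>v v"
    unfolding O_module_def Hgen_def smult_class eval_gen ..
  show "v \<in> carrier_vec (2*D+1) \<Longrightarrow> z \<odot>\<^bsub>complex_space r0 r1 (O_module r0 r1 D \<rho> \<sigma> c s lam mu)\<^esub> v = z \<cdot>\<^sub>v v"
    unfolding O_module_def complex_space_def module.simps smult_class eval_scalar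
    by (rule scalar_mat_vec)
qed

end

theory Submission
  imports Defs
begin

text \<open>
  The whole statement is about where the unit vectors go. The elements \<open>A = u\<^sub>0 t\<^sub>0\<close> and
  \<open>B = t\<^sub>1 u\<^sub>1\<close> act by products of block diagonal matrices with matching blocks, and on each
  block the parameters are chosen so that \<open>P(c) R(r\<^sub>0, \<lambda>, c)\<close> and \<open>S(r\<^sub>1, s) N(s, \<mu>)\<close> collapse to
  \<open>diag(\<lambda>, 0)\<close> and \<open>diag(\<mu>, 0)\<close>. Hence \<open>A\<close> and \<open>B\<close> are diagonal (lemmas \<open>O_mat_U0_T0\<close> and
  \<open>O_mat_T1_U1\<close>): the blocks of \<open>A\<close> start at the even positions \<open>2 i\<close>, those of \<open>B\<close>, displaced
  by the leading \<open>1 \<times> 1\<close> block, at the odd positions \<open>2 i + 1\<close>. So the vector at an even position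
  is an eigenvector of \<open>A\<close> killed by \<open>B\<close>, with eigenvalue \<open>\<lambda>\<^sub>i\<close>, or \<open>\<rho>\<close> at the last one; at an odd
  position the roles of \<open>A\<close> and \<open>B\<close> are exchanged and the eigenvalue is \<open>\<mu>\<^sub>i\<close>.

  The stability of the lines and planes is the same block structure, read off from \<open>t\<^sub>0\<close> and \<open>t\<^sub>1\<close>
  themselves: a block diagonal matrix maps the unit vectors belonging to a block into their own
  span (lemmas \<open>diag_snoc_columns\<close> and \<open>diag_Cons_columns\<close>).

  That the unit vectors form a basis is the standard fact about coordinate space. It has to be
  transported, because the complex vector space underlying the module acts through matrices
  \<open>z I\<close> rather than by scalar multiplication, and the two agree only on vectors of the right
  dimension; \<open>span_same_action\<close> and \<open>basis_same_action\<close> do this.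
\<close>


section \<open>Modules with the same action\<close>

context Module.module
begin

lemma module_same_action:
  fixes M' :: "('a, 'c, 'd) module_scheme"
  assumes "carrier M' = carrier M" "add M' = add M" "zero M' = zero M"
    and "\<And>a x. a \<in> carrier R \<Longrightarrow> x \<in> carrier M \<Longrightarrow> a \<odot>\<^bsub>M'\<^esub> x = a \<odot>\<^bsub>M\<^esub> x"
  shows "Module.module R M'"
proof (rule moduleI)
  have "add_monoid M' = add_monoid M"
    by (simp add: assms(1-3))
  then show "abelian_group M'"
    using M.abelian_group_axioms
    by (simp only: abelian_group_def abelian_group_axioms_def abelian_monoid_def)
qed (simp_all add: assms is_cring smult_l_distr smult_r_distr smult_assoc1)

text \<open>A linear combination of elements of the carrier involves only the addition and the action on
  the carrier, so notions defined by linear combinations cannot tell the two modules apart.\<close>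

lemma
  fixes M' :: "('a, 'c, 'd) module_scheme"
  assumes eqs: "carrier M' = carrier M" "add M' = add M" "zero M' = zero M"
    and act: "\<And>a x. a \<in> carrier R \<Longrightarrow> x \<in> carrier M \<Longrightarrow> a \<odot>\<^bsub>M'\<^esub> x = a \<odot>\<^bsub>M\<^esub> x"
    and S: "S \<subseteq> carrier M"
  shows span_same_action: "LinearCombinations.module.span R M' S = span S"
    and lin_dep_same_action: "LinearCombinations.module.lin_dep R M' S = lin_dep S"
proof -
  interpret M': Module.module R M'
    using eqs act by (rule module_same_action)
  \<comment> \<open>Finite sums are products in the additive monoid, which is literally the same for both.\<close>
  have am: "add_monoid M' = add_monoid M"
    by (simp add: eqs)
  have lc: "M'.lincomb a A = lincomb a A" if "A \<subseteq> S" "a \<in> A \<rightarrow> carrier R" for a A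
    unfolding M'.lincomb_def lincomb_def finsum_def am unfolding finsum_def[symmetric]
    using that S by (intro finsum_cong') (auto simp: act Pi_iff subset_iff)
  show "M'.span S = span S"
    unfolding M'.span_def span_def by (intro Collect_cong iff_exI) (auto simp: lc)
  show "M'.lin_dep S = lin_dep S"
    unfolding M'.lin_dep_def lin_dep_def eqs by (simp add: lc cong: conj_cong)
qed

end

lemma basis_same_action:
  fixes V V' :: "('a, 'c, 'd) module_scheme"
  assumes "vectorspace K V"
    and eqs: "carrier V' = carrier V" "add V' = add V" "zero V' = zero V"
    and act: "\<And>a x. a \<in> carrier K \<Longrightarrow> x \<in> carrier V \<Longrightarrow> a \<odot>\<^bsub>V'\<^esub> x = a \<odot>\<^bsub>V\<^esub> x"
    and "vectorspace.basis K V S"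
  shows "vectorspace.basis K V' S"
proof -
  interpret V: vectorspace K V by fact
  interpret V': vectorspace K V'
    using V.module_same_action[OF eqs act] V.field_axioms by (intro vectorspace.intro)
  show ?thesis
    using \<open>V.basis S\<close> V.span_same_action[OF eqs act] V.lin_dep_same_action[OF eqs act]
    unfolding V.basis_def V'.basis_def by (simp add: eqs)
qed


section \<open>Block diagonal matrices and unit vectors\<close>

text \<open>The columns of a block diagonal matrix that run through the block \<open>A\<close> carry a shifted copy of
  \<open>A\<close> and zeros elsewhere. Squareness of the other blocks makes the row and the column offset of
  \<open>A\<close> the same.\<close>

lemma diag_block_index_in_block:
  assumes "\<forall>B\<in>set As. square_mat B" "square_mat A" "\<forall>B\<in>set Bs. square_mat B"
    and "off = sum_list (map dim_row As)" "j < dim_row A"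
    and "i < sum_list (map dim_row (As @ A # Bs))"
  shows "diag_block_mat (As @ A # Bs) $$ (i, off + j) =
    (if off \<le> i \<and> i < off + dim_row A then A $$ (i - off, j) else 0)"
  using assms(1,4,6)
proof (induction As arbitrary: i off)
  case Nil
  have "map dim_col Bs = map dim_row Bs"
    using assms(3) by simp
  then show ?case
    using Nil assms(2,5) by (auto simp: Let_def dim_diag_block_mat)
next
  case (Cons B As)
  have c: "map dim_col As = map dim_row As" "map dim_col Bs = map dim_row Bs"
    using Cons.prems assms(3) by simp_all
  have "diag_block_mat (As @ A # Bs) $$ (i - dim_row B, sum_list (map dim_row As) + j) =
    (if off \<le> i \<and> i < off + dim_row A then A $$ (i - off, j) else 0)" if "dim_row B \<le> i"
    using Cons.IH[of "sum_list (map dim_row As)" "i - dim_row B"] Cons.prems that by auto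
  then show ?case
    using Cons.prems assms(2,5) by (auto simp: Let_def dim_diag_block_mat c)
qed

lemma mat_mult_unit_vec:
  assumes "(A :: 'a :: semiring_1 mat) \<in> carrier_mat m n" "j < n"
  shows "A *\<^sub>v unit_vec n j = col A j"
  using assms by (intro eq_vecI) auto

lemma scalar_block_in_diag:
  fixes A :: "complex mat"
  assumes "A = diag_block_mat (As @ scalar_block z # Bs)" "A \<in> carrier_mat n n"
    and sq: "\<forall>B\<in>set As. square_mat B" "\<forall>B\<in>set Bs. square_mat B"
    and off: "off = sum_list (map dim_row As)"
  shows "A *\<^sub>v unit_vec n off = z \<cdot>\<^sub>v unit_vec n off"
proof -
  have n: "n = sum_list (map dim_row (As @ scalar_block z # Bs))"
    using assms(1,2) by (metis carrier_matD(1) dim_diag_block_mat(1))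
  have i: "A $$ (i, off) = (if i = off then z else 0)" if "i < n" for i
    using diag_block_index_in_block[OF sq(1) _ sq(2) off, of "scalar_block z" 0 i] that
    by (auto simp: assms(1) n block_index)
  have "off < n" using n off by simp
  then show ?thesis
    using assms(2) by (intro eq_vecI) (auto simp: mat_mult_unit_vec[OF assms(2)] i)
qed

lemma block2_in_diag:
  fixes A B :: "complex mat"
  assumes "A = diag_block_mat (As @ B # Bs)" "A \<in> carrier_mat n n"
    and sq: "\<forall>B\<in>set As. square_mat B" "\<forall>B\<in>set Bs. square_mat B"
    and B: "B \<in> carrier_mat 2 2" and j: "j < 2"
    and off: "off = sum_list (map dim_row As)"
  shows "A *\<^sub>v unit_vec n (off + j) =
    B $$ (0, j) \<cdot>\<^sub>v unit_vec n off + B $$ (1, j) \<cdot>\<^sub>v unit_vec n (off + 1)"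
proof -
  have n: "n = sum_list (map dim_row (As @ B # Bs))"
    using assms(1,2) by (metis carrier_matD(1) dim_diag_block_mat(1))
  have sB: "square_mat B" using B by auto
  have i: "A $$ (i, off + j) = (if i = off then B $$ (0, j) else if i = off + 1 then B $$ (1, j) else 0)"
    if "i < n" for i
  proof -
    consider "i = off" | "i = off + 1" | "i < off \<or> i \<ge> off + 2" by linarith
    then show ?thesis
      using diag_block_index_in_block[OF sq(1) sB sq(2) off, of j i] that B j
      by cases (auto simp: assms(1) n)
  qed
  have "off + j < n" "off + 1 < n" using n off B j by simp_all
  then show ?thesis
    using assms(2) by (intro eq_vecI) (auto simp: mat_mult_unit_vec[OF assms(2)] i)
qed

text \<open>The two block patterns of the modules. With the \<open>1 \<times> 1\<close> block last, the planes spanned by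
  positions \<open>2 i\<close> and \<open>2 i + 1\<close> are stable; with it first, those spanned by positions \<open>2 i + 1\<close> and
  \<open>2 i + 2\<close> are. The overlap of the two patterns links consecutive basis vectors.\<close>

lemma diag_snoc_columns:
  fixes f :: "nat \<Rightarrow> complex mat"
  assumes f: "\<And>i. f i \<in> carrier_mat 2 2"
    and A: "A = diag_block_mat (map f [0..<D] @ [scalar_block z])" "A \<in> carrier_mat n n"
  shows "A *\<^sub>v unit_vec n (2 * D) = z \<cdot>\<^sub>v unit_vec n (2 * D)"
    and "i < D \<Longrightarrow> j < 2 \<Longrightarrow> A *\<^sub>v unit_vec n (2 * i + j) =
      f i $$ (0, j) \<cdot>\<^sub>v unit_vec n (2 * i) + f i $$ (1, j) \<cdot>\<^sub>v unit_vec n (2 * i + 1)"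
proof -
  have sq: "dim_row (f i) = 2" "dim_col (f i) = 2" for i using f[of i] by auto
  show "A *\<^sub>v unit_vec n (2 * D) = z \<cdot>\<^sub>v unit_vec n (2 * D)"
    using A sq by (intro scalar_block_in_diag[where As = "map f [0..<D]" and Bs = "[]"])
      (auto simp: o_def sum_list_triv)
  assume i: "i < D" "j < 2"
  then have "[0..<D] = [0..<i] @ i # [Suc i..<D]"
    using upt_add_eq_append[of 0 i "D - i"] upt_conv_Cons[of i D] by simp
  then have "map f [0..<D] @ [scalar_block z] = map f [0..<i] @ f i # (map f [Suc i..<D] @ [scalar_block z])"
    by simp
  with A have eq: "A = diag_block_mat (map f [0..<i] @ f i # (map f [Suc i..<D] @ [scalar_block z]))"
    by (simp only:)
  then show "A *\<^sub>v unit_vec n (2 * i + j) =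
      f i $$ (0, j) \<cdot>\<^sub>v unit_vec n (2 * i) + f i $$ (1, j) \<cdot>\<^sub>v unit_vec n (2 * i + 1)"
    by (intro block2_in_diag[OF eq A(2) _ _ f i(2)]) (auto simp: o_def sum_list_triv sq)
qed

lemma diag_Cons_columns:
  fixes f :: "nat \<Rightarrow> complex mat"
  assumes f: "\<And>i. f i \<in> carrier_mat 2 2"
    and A: "A = diag_block_mat (scalar_block z # map f [0..<D])" "A \<in> carrier_mat n n"
  shows "A *\<^sub>v unit_vec n 0 = z \<cdot>\<^sub>v unit_vec n 0"
    and "i < D \<Longrightarrow> j < 2 \<Longrightarrow> A *\<^sub>v unit_vec n (2 * i + 1 + j) =
      f i $$ (0, j) \<cdot>\<^sub>v unit_vec n (2 * i + 1) + f i $$ (1, j) \<cdot>\<^sub>v unit_vec n (2 * i + 1 + 1)"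
proof -
  have sq: "dim_row (f i) = 2" "dim_col (f i) = 2" for i using f[of i] by auto
  show "A *\<^sub>v unit_vec n 0 = z \<cdot>\<^sub>v unit_vec n 0"
    using A sq by (intro scalar_block_in_diag[where As = "[]" and Bs = "map f [0..<D]"])
      auto
  assume i: "i < D" "j < 2"
  then have "[0..<D] = [0..<i] @ i # [Suc i..<D]"
    using upt_add_eq_append[of 0 i "D - i"] upt_conv_Cons[of i D] by simp
  then have "scalar_block z # map f [0..<D] = (scalar_block z # map f [0..<i]) @ f i # map f [Suc i..<D]"
    by simp
  with A have eq: "A = diag_block_mat ((scalar_block z # map f [0..<i]) @ f i # map f [Suc i..<D])"
    by (simp only:)
  then show "A *\<^sub>v unit_vec n (2 * i + 1 + j) =
      f i $$ (0, j) \<cdot>\<^sub>v unit_vec n (2 * i + 1) + f i $$ (1, j) \<cdot>\<^sub>v unit_vec n (2 * i + 1 + 1)"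
    by (intro block2_in_diag[OF eq A(2) _ _ f i(2)]) (auto simp: o_def sum_list_triv sq)
qed


lemma O_mat_U0_T0:
  assumes "\<forall>i<D. lam i \<noteq> 0" "\<forall>i<D. c i \<noteq> 0"
  shows "O_mat r0 r1 D \<rho> \<sigma> c s lam mu U0 * O_mat r0 r1 D \<rho> \<sigma> c s lam mu T0 =
    diag_block_mat (map (\<lambda>i. corner (lam i)) [0..<D] @ [scalar_block \<rho>])"
proof -
  have blocks: "map (\<lambda>i. P_block (c i) * R_block r0 (lam i) (c i)) [0..<D] = map (\<lambda>i. corner (lam i)) [0..<D]"
    using assms by (simp add: PR)
  show ?thesis
    unfolding O_mat.simps
    by (subst diag_block_mult[OF same_square_lists(1)], (rule block_carrier)+)
      (simp only: map2_same_snoc scalar_mult mult_1 blocks)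
qed

lemma O_mat_T1_U1:
  assumes "\<forall>i<D. s i \<noteq> 0"
  shows "O_mat r0 r1 D \<rho> \<sigma> c s lam mu T1 * O_mat r0 r1 D \<rho> \<sigma> c s lam mu U1 =
    diag_block_mat (scalar_block 0 # map (\<lambda>i. corner (mu i)) [0..<D])"
proof -
  have blocks: "map (\<lambda>i. S_block r1 (s i) * N_block (s i) (mu i)) [0..<D] = map (\<lambda>i. corner (mu i)) [0..<D]"
    using assms by (simp add: SN)
  show ?thesis
    unfolding O_mat.simps
    by (subst diag_block_mult[OF same_square_lists(2)], (rule block_carrier)+)
      (simp only: list.simps zip_Cons_Cons prod.case map2_same scalar_mult mult_zero_right blocks)
qed


section \<open>Spans stable under a matrix\<close>

context vec_space
begin

text \<open>The vectors that \<open>A\<close> maps into \<open>span S\<close> form a submodule, so it suffices to test generators.\<close>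

lemma mult_mat_vec_span:
  assumes A: "A \<in> carrier_mat n n" and S: "S \<subseteq> carrier_vec n"
    and gen: "\<And>v. v \<in> S \<Longrightarrow> A *\<^sub>v v \<in> span S"
    and w: "w \<in> span S"
  shows "A *\<^sub>v w \<in> span S"
proof -
  let ?N = "{v \<in> carrier_vec n. A *\<^sub>v v \<in> span S}"
  have "submodule class_ring ?N V"
  proof (rule submodule.intro)
    show "Module.module class_ring V" by (rule vec_module)
    show "?N \<subseteq> carrier V" by auto
    have "A *\<^sub>v 0\<^sub>v n = 0\<^sub>v n"
      using A by (intro eq_vecI) auto
    then show "\<zero>\<^bsub>V\<^esub> \<in> ?N"
      using span_zero by (simp add: module_vec_simps)
  next
    fix v w assume "v \<in> ?N" "w \<in> ?N"
    then show "v \<oplus>\<^bsub>V\<^esub> w \<in> ?N"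
      using S by (simp add: module_vec_simps mult_add_distrib_mat_vec[OF A] span_add1)
  next
    fix z v assume "v \<in> ?N"
    then show "z \<odot>\<^bsub>V\<^esub> v \<in> ?N"
      using S by (simp add: module_vec_simps mult_mat_vec[OF A] smult_in_span)
  qed
  then have "span S \<subseteq> ?N"
    using gen S by (intro span_is_subset) auto
  then show ?thesis using w by blast
qed

lemma smult_in_span_singleton:
  assumes "u \<in> carrier_vec n"
  shows "x \<cdot>\<^sub>v u \<in> span {u}"
  using assms in_own_span[of "{u}"] by (intro smult_in_span) simp_all

lemma add_smult_in_span_pair:
  assumes "u \<in> carrier_vec n" "v \<in> carrier_vec n"
  shows "x \<cdot>\<^sub>v u + y \<cdot>\<^sub>v v \<in> span {u, v}"
proof -
  have c: "{u, v} \<subseteq> carrier_vec n" using assms by simp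
  have "u \<in> span {u, v}" "v \<in> span {u, v}" using in_own_span[OF c] by simp_all
  then show ?thesis
    by (intro span_add1[OF c] smult_in_span[OF c])
qed

end


section \<open>The adapted block basis\<close>

theorem proposition3p7:
  fixes D :: nat and r0 r1 \<rho> \<sigma> :: complex and c s lam mu :: "nat \<Rightarrow> complex"
  assumes "r0 \<noteq> 0" and "r1 \<noteq> 0"
    and "\<rho> \<in> {r0, inverse r0}" and "\<sigma> \<in> {r1, inverse r1}"
    and "\<forall>i<D. c i \<noteq> 0" and "\<forall>i<D. s i \<noteq> 0"
    and "\<forall>i<D. lam i \<noteq> 0" and "\<forall>i<D. mu i \<noteq> 0"
  shows "odd_adapted_block_basis r0 r1 D (O_module r0 r1 D \<rho> \<sigma> c s lam mu) (O_basis D)"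
proof -
  define n where "n = 2 * D + 1"
  let ?X = "O_mat r0 r1 D \<rho> \<sigma> c s lam mu"
  let ?V = "O_module r0 r1 D \<rho> \<sigma> c s lam mu"
  let ?e = "unit_vec n :: nat \<Rightarrow> complex vec"
  interpret H_rep n ?X r0 r1
    unfolding n_def by (rule O_mat_rels[OF assms])
  interpret V: left_module "Htilde r0 r1" ?V
    by (rule O_module_left_module(1)[OF assms])
  interpret E: vec_space "TYPE(complex)" n .
  note act = O_module_left_module(2)[OF assms]
  note scal = O_module_left_module(3)[OF assms, folded n_def]
  have carr [simp]: "carrier ?V = carrier_vec n"
    by (simp add: O_module_def matrix_module_def n_def)
  have eqs: "carrier (complex_space r0 r1 ?V) = carrier (module_vec TYPE(complex) n)"
    "add (complex_space r0 r1 ?V) = add (module_vec TYPE(complex) n)"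
    "zero (complex_space r0 r1 ?V) = zero (module_vec TYPE(complex) n)"
    by (simp_all add: complex_space_def O_module_def matrix_module_def module_vec_simps n_def)
  have sm: "a \<odot>\<^bsub>complex_space r0 r1 ?V\<^esub> x = a \<odot>\<^bsub>module_vec TYPE(complex) n\<^esub> x"
    if "x \<in> carrier (module_vec TYPE(complex) n)" for a x
    using that scal by (simp add: module_vec_simps)
  have basis: "ordered_basis r0 r1 ?V (O_basis D)"
    unfolding ordered_basis_def O_basis_def n_def[symmetric]
    using E.unit_vecs_distinct E.unit_vecs_basis
    by (intro conjI basis_same_action[OF vec_vs eqs sm])
  have span: "complex_span r0 r1 ?V S = E.span S" if "S \<subseteq> carrier_vec n" for S
    unfolding complex_span_def
    by (rule E.span_same_action) (use that eqs sm in \<open>simp_all add: module_vec_simps\<close>)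
  have nth: "O_basis D ! i = ?e i" if "i \<le> 2 * D" for i
  proof -
    have "i < n" using that by (simp add: n_def)
    then show ?thesis unfolding O_basis_def n_def[symmetric] unit_vecs_def by simp
  qed
  have gen_carrier: "Hgen r0 r1 g \<in> carrier (Htilde r0 r1)" for g
    by (auto simp: carrier_H Hgen_def)
  have HA: "HA r0 r1 \<odot>\<^bsub>?V\<^esub> v = (?X U0 * ?X T0) *\<^sub>v v"
    and HB: "HB r0 r1 \<odot>\<^bsub>?V\<^esub> v = (?X T1 * ?X U1) *\<^sub>v v" if "v \<in> carrier_vec n" for v
    using that V.smult_assoc1[OF gen_carrier gen_carrier]
    by (simp_all add: HA_def HB_def act assoc_mult_mat_vec[OF X_carrier X_carrier] del: O_mat.simps)
  have weightI: "v \<in> weight_space r0 r1 ?V \<alpha> \<beta>"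
    if "v \<in> carrier_vec n" "(?X U0 * ?X T0) *\<^sub>v v = \<alpha> \<cdot>\<^sub>v v" "(?X T1 * ?X U1) *\<^sub>v v = \<beta> \<cdot>\<^sub>v v" for v \<alpha> \<beta>
    using that by (simp add: weight_space_def HA HB scal del: O_mat.simps)
  note A = O_mat_U0_T0[OF assms(7,5)] and B = O_mat_T1_U1[OF assms(6)]
  have e: "?e i \<in> carrier_vec n" for i by simp
  note Ac = diag_snoc_columns[OF corner_dim(3) A mult_carrier_mat[OF X_carrier X_carrier]]
  note Bc = diag_Cons_columns[OF corner_dim(3) B mult_carrier_mat[OF X_carrier X_carrier]]
  have corner: "corner z $$ (0, 0) = z" "corner z $$ (0, 1) = 0" "corner z $$ (1, 0) = 0" "corner z $$ (1, 1) = 0" for z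
    by (simp_all add: corner_def)
  have z: "0 \<cdot>\<^sub>v v = 0\<^sub>v n" if "v \<in> carrier_vec n" for v :: "complex vec"
    using that by auto
  have A_even: "(?X U0 * ?X T0) *\<^sub>v ?e (2 * i) = lam i \<cdot>\<^sub>v ?e (2 * i)"
    and A_odd: "(?X U0 * ?X T0) *\<^sub>v ?e (2 * i + 1) = 0 \<cdot>\<^sub>v ?e (2 * i + 1)" 
    and B_odd: "(?X T1 * ?X U1) *\<^sub>v ?e (2 * i + 1) = mu i \<cdot>\<^sub>v ?e (2 * i + 1)"
    and B_even: "(?X T1 * ?X U1) *\<^sub>v ?e (2 * i + 2) = 0 \<cdot>\<^sub>v ?e (2 * i + 2)" if "i < D" for i
    using Ac(2)[OF that, of 0] Ac(2)[OF that, of 1] Bc(2)[OF that, of 0] Bc(2)[OF that, of 1]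
    unfolding corner by (simp_all add: z del: O_mat.simps)
  \<comment> \<open>An even position \<open>2 i\<close> is the second one of block \<open>i - 1\<close> of \<open>B\<close>; position 0 is its scalar block.\<close>
  have B_even': "(?X T1 * ?X U1) *\<^sub>v ?e (2 * i) = 0 \<cdot>\<^sub>v ?e (2 * i)" if "i \<le> D" for i
    using that Bc(1) B_even[of "i - 1"] by (cases i) (simp_all del: O_mat.simps)
  \<comment> \<open>The last vector lies in the scalar block of \<open>A\<close>, so its eigenvalue is \<open>\<rho>\<close>; for \<open>D = 0\<close> it is the only one.\<close>
  let ?l = "\<lambda>i. if i < D then lam i else \<rho>"
  have \<rho>: "\<rho> \<noteq> 0" using assms by auto
  have a: "O_basis D ! (2 * i) \<in> weight_space r0 r1 ?V (?l i) 0" if "i \<le> D" for i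
  proof -
    have "(?X U0 * ?X T0) *\<^sub>v ?e (2 * i) = ?l i \<cdot>\<^sub>v ?e (2 * i)"
      using that Ac(1) A_even by (cases "i = D") (simp_all del: O_mat.simps)
    then show ?thesis
      using that B_even'[OF that] by (simp only: nth mult_le_mono2) (rule weightI[OF e])
  qed
  have b: "O_basis D ! (2 * i + 1) \<in> weight_space r0 r1 ?V 0 (mu i)" if "i < D" for i
  proof -
    have "2 * i + 1 \<le> 2 * D" using that by simp
    then show ?thesis
      using A_odd[OF that] B_odd[OF that] by (simp only: nth) (rule weightI[OF e])
  qed
  have pres: "preserves ?V (Hgen r0 r1 g) (complex_span r0 r1 ?V S)"
    if "S \<subseteq> carrier_vec n" "\<And>v. v \<in> S \<Longrightarrow> ?X g *\<^sub>v v \<in> E.span S" for g S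
    using E.mult_mat_vec_span[OF X_carrier that]
    unfolding preserves_def span[OF that(1)] act by blast
  note T0c = diag_snoc_columns[OF block_carrier(1) O_mat.simps(1) X_carrier]
  note T1c = diag_Cons_columns[OF block_carrier(3) O_mat.simps(3) X_carrier]
  have t0_last: "preserves ?V (Hgen r0 r1 T0) (complex_span r0 r1 ?V {O_basis D ! (2 * D)})"
    unfolding nth[OF order_refl]
    by (rule pres) (simp_all only: singleton_iff T0c(1) E.smult_in_span_singleton[OF e] insert_subset empty_subsetI e simp_thms)
  have t1_first: "preserves ?V (Hgen r0 r1 T1) (complex_span r0 r1 ?V {O_basis D ! (2 * 0)})"
    unfolding mult_0_right nth[OF zero_le]
    by (rule pres) (simp_all only: singleton_iff T1c(1) E.smult_in_span_singleton[OF e] insert_subset empty_subsetI e simp_thms)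
  have t0_pair: "preserves ?V (Hgen r0 r1 T0)
      (complex_span r0 r1 ?V {O_basis D ! (2 * i), O_basis D ! (2 * i + 1)})" if "i < D" for i
  proof -
    have nn: "O_basis D ! (2 * i) = ?e (2 * i)" "O_basis D ! (2 * i + 1) = ?e (2 * i + 1)"
      using that by (simp_all add: nth)
    have "?X T0 *\<^sub>v ?e (2 * i + j) \<in> E.span {?e (2 * i), ?e (2 * i + 1)}" if "j < 2" for j
      unfolding T0c(2)[OF \<open>i < D\<close> that] by (rule E.add_smult_in_span_pair[OF e e])
    from this[of 0] this[of 1] show ?thesis
      unfolding nn by (intro pres) (auto simp del: O_mat.simps)
  qed
  have t1_pair: "preserves ?V (Hgen r0 r1 T1)
      (complex_span r0 r1 ?V {O_basis D ! (2 * i + 1), O_basis D ! (2 * (i + 1))})" if "i < D" for i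
  proof -
    have nn: "O_basis D ! (2 * i + 1) = ?e (2 * i + 1)" "O_basis D ! (2 * (i + 1)) = ?e (2 * i + 1 + 1)"
      using that nth[of "2 * (i + 1)"] by (simp_all add: nth)
    have "?X T1 *\<^sub>v ?e (2 * i + 1 + j) \<in> E.span {?e (2 * i + 1), ?e (2 * i + 1 + 1)}" if "j < 2" for j
      unfolding T1c(2)[OF \<open>i < D\<close> that] by (rule E.add_smult_in_span_pair[OF e e])
    from this[of 0] this[of 1] show ?thesis
      unfolding nn by (intro pres) (auto simp del: O_mat.simps)
  qed
  have len: "length (O_basis D) = 2 * D + 1" by (simp add: O_basis_def unit_vecs_def)
  show ?thesis
  proof (cases "D = 0")
    case True
    then show ?thesis
      using V.left_module_axioms len basis \<rho> a[of 0]
      unfolding odd_adapted_block_basis_def Let_def by auto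
  next
    case False
    have l: "?l i \<noteq> 0" if "i \<le> D" for i using \<rho> assms(7) by simp
    show ?thesis
      unfolding odd_adapted_block_basis_def Let_def if_not_P[OF False]
      by (intro conjI V.left_module_axioms len basis, rule exI[of _ ?l], rule exI[of _ mu],
          intro conjI allI impI l assms(8)[rule_format] a b t0_last t1_first t0_pair t1_pair)
  qed
qed

end
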